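(* Let $f:[0,1]\to\mathbb{R}$ be a continuous function, let $0<p_0<p_1$ and $\theta\in[0,1]$, and set $p=(1-\theta)p_0+\theta p_1$. Then $$\mathrm{Pers}_p^p(f)\;\le\;\frac{p}{p_0^{1-\theta}\,p_1^{\theta}}\;\bigl(\mathrm{Pers}_{p_0}^{p_0}(f)\bigr)^{1-\theta}\,\bigl(\mathrm{Pers}_{p_1}^{p_1}(f)\bigr)^{\theta}.$$
   Context: For a continuous $f:[0,1]\to\mathbb{R}$ put, for $x<y$, $d_f(x,y)=f(x)+f(y)-2\min_{[x,y]}f$. This is a pseudo-distance, and the quotient $T_f=[0,1]/\{d_f=0\}$ is a rooted $\mathbb{R}$-tree, the root being the image of a point where $f$ attains its infimum; $f$ descends to $T_f$. A point $\tau'$ is above $\tau$ if $\tau$ lies on the geodesic from the root to $\tau'$. For $\tau\in T_f$, $h(\tau)$ is the distance from $\tau$ to the highest (with respect to $f$) leaf above $\tau$, i.e. $h(\tau)=\max\{f(\tau'):\tau'\text{ above }\tau\}-f(\tau)$. Let $\lambda$ be the unique atomless Borel measure on $T_f$ giving every geodesic segment measure equal to its length. For $p>0$, $\mathrm{Pers}_p^p(f):=p\int_{T_f}h(\tau)^{p-1}\,\lambda(d\tau)\in[0,\infty]$ (equivalently, the sum of the $p$-th powers of the lengths of the bars of the $H_0$ superlevel-set barcode of $f$, the infinite bar being given length $\sup f-\inf f$). The convention $a^0=1$ is used for $a\in[0,\infty]$. *)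

theory Defs
  imports "HOL-Analysis.Analysis"
begin

section \<open>The tree coded by a continuous function on the unit interval\<close>

text \<open>The pseudo-distance is extended symmetrically to all pairs of points.\<close>

definition path_min :: "(real \<Rightarrow> real) \<Rightarrow> real \<Rightarrow> real \<Rightarrow> real" where
  "path_min f x y = Inf (f ` {min x y..max x y})"

definition tree_pdist :: "(real \<Rightarrow> real) \<Rightarrow> real \<Rightarrow> real \<Rightarrow> real" where
  "tree_pdist f x y = f x + f y - 2 * path_min f x y"

definition tree_rel :: "(real \<Rightarrow> real) \<Rightarrow> (real \<times> real) set" where
  "tree_rel f = {(x, y). x \<in> {0..1} \<and> y \<in> {0..1} \<and> tree_pdist f x y = 0}"

definition tree :: "(real \<Rightarrow> real) \<Rightarrow> real set set" where
  "tree f = {0..1} // tree_rel f"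

text \<open>
  The pseudo-distance and \<open>f\<close> itself are constant on classes, so the images below are
  singletons. The value 0 off the tree only serves the locale \<open>Metric_space\<close>, which wants
  nonnegativity and symmetry on the whole type.
\<close>

definition tree_dist :: "(real \<Rightarrow> real) \<Rightarrow> real set \<Rightarrow> real set \<Rightarrow> real" where
  "tree_dist f \<sigma> \<tau> =
     (if \<sigma> \<in> tree f \<and> \<tau> \<in> tree f then the_elem ((\<lambda>(x, y). tree_pdist f x y) ` (\<sigma> \<times> \<tau>)) else 0)"

definition tree_fun :: "(real \<Rightarrow> real) \<Rightarrow> real set \<Rightarrow> real" where
  "tree_fun f \<tau> = the_elem (f ` \<tau>)"

definition tree_root :: "(real \<Rightarrow> real) \<Rightarrow> real set" where
  "tree_root f = (THE \<tau>. \<tau> \<in> tree f \<and> (\<exists>x\<in>\<tau>. \<forall>y\<in>{0..1}. f x \<le> f y))"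

definition geodesic_segment ::
    "'a set \<Rightarrow> ('a \<Rightarrow> 'a \<Rightarrow> real) \<Rightarrow> 'a \<Rightarrow> 'a \<Rightarrow> 'a set \<Rightarrow> bool" where
  "geodesic_segment M d a b S \<longleftrightarrow>
     (\<exists>g. g \<in> {0..d a b} \<rightarrow> M \<and> g 0 = a \<and> g (d a b) = b \<and>
          (\<forall>s\<in>{0..d a b}. \<forall>t\<in>{0..d a b}. d (g s) (g t) = \<bar>s - t\<bar>) \<and>
          S = g ` {0..d a b})"

definition tree_above :: "(real \<Rightarrow> real) \<Rightarrow> real set \<Rightarrow> real set set" where
  "tree_above f \<tau> =
     {\<tau>' \<in> tree f. \<exists>S. geodesic_segment (tree f) (tree_dist f) (tree_root f) \<tau>' S \<and> \<tau> \<in> S}"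

text \<open>For continuous \<open>f\<close> the tree is compact, so this supremum is a maximum.\<close>

definition tree_height :: "(real \<Rightarrow> real) \<Rightarrow> real set \<Rightarrow> real" where
  "tree_height f \<tau> = Sup (tree_fun f ` tree_above f \<tau>) - tree_fun f \<tau>"

section \<open>Length measures and the persistence functional\<close>

text \<open>
  Atomless means that points are null. These conditions need not determine the measure: if the
  leaves are uncountable, a diffuse measure carried by the leaves may be added to it, because a
  geodesic segment contains at most two leaves. The length measure of the tree in the
  strict sense is the one among them that gives the set of leaves measure 0; the predicate
  admits all of them.
\<close>

definition length_measure :: "(real \<Rightarrow> real) \<Rightarrow> real set measure \<Rightarrow> bool" where
  "length_measure f \<Lambda> \<longleftrightarrow>
     space \<Lambda> = tree f \<and>
     sets \<Lambda> = sigma_sets (tree f) {U. openin (Metric_space.mtopology (tree f) (tree_dist f)) U} \<and>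
     (\<forall>\<tau>\<in>tree f. emeasure \<Lambda> {\<tau>} = 0) \<and>
     (\<forall>a\<in>tree f. \<forall>b\<in>tree f. \<forall>S. geodesic_segment (tree f) (tree_dist f) a b S \<longrightarrow>
        emeasure \<Lambda> S = ennreal (tree_dist f a b))"

text \<open>
  Powers on \<open>[0, \<infinity>]\<close> with \<open>a\<^sup>0 = 1\<close> for every \<open>a\<close>; unlike for \<open>powr\<close>, a negative power of 0
  is \<open>\<infinity>\<close>.
\<close>

definition ennpowr :: "ennreal \<Rightarrow> real \<Rightarrow> ennreal" where
  "ennpowr a r =
     (if r = 0 then 1
      else if a = 0 then (if r > 0 then 0 else \<infinity>)
      else if a = \<infinity> then (if r > 0 then \<infinity> else 0)
      else ennreal (enn2real a powr r))"

text \<open>This is the \<open>p\<close>-th power \<open>Pers\<^sub>p\<^sup>p(f)\<close>, with respect to the length measure \<open>\<Lambda>\<close>.\<close>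

definition Pers_pow :: "(real \<Rightarrow> real) \<Rightarrow> real set measure \<Rightarrow> real \<Rightarrow> ennreal" where
  "Pers_pow f \<Lambda> p = ennreal p * (\<integral>\<^sup>+\<tau>. ennpowr (ennreal (tree_height f \<tau>)) (p - 1) \<partial>\<Lambda>)"

section \<open>Well-definedness\<close>

lemma bdd_below_image_path:
  fixes f :: "real \<Rightarrow> real"
  assumes "continuous_on {0..1} f" "x \<in> {0..1}" "y \<in> {0..1}"
  shows "bdd_below (f ` {min x y..max x y})"
proof -
  have "compact (f ` {0..1})"
    using assms(1) compact_Icc compact_continuous_image by blast
  then have "bdd_below (f ` {0..1})"
    by (simp add: bounded_imp_bdd_below compact_imp_bounded)
  moreover have "f ` {min x y..max x y} \<subseteq> f ` {0..1}"
    using assms(2,3) by (intro image_mono) auto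
  ultimately show ?thesis
    by (rule bdd_below_mono)
qed

lemma path_min_le:
  assumes "continuous_on {0..1} f" "x \<in> {0..1}" "y \<in> {0..1}" "z \<in> {min x y..max x y}"
  shows "path_min f x y \<le> f z"
  unfolding path_min_def using assms bdd_below_image_path by (intro cInf_lower) auto

lemma path_min_commute: "path_min f x y = path_min f y x"
  by (simp add: path_min_def min.commute max.commute)

lemma tree_pdist_commute: "tree_pdist f x y = tree_pdist f y x"
  by (simp add: tree_pdist_def path_min_commute)

lemma tree_pdist_refl: "tree_pdist f x x = 0"
  by (simp add: tree_pdist_def path_min_def)

lemma tree_pdist_ge:
  assumes "continuous_on {0..1} f" "x \<in> {0..1}" "y \<in> {0..1}"
  shows "\<bar>f x - f y\<bar> \<le> tree_pdist f x y"
  using path_min_le[OF assms, of x] path_min_le[OF assms, of y] by (auto simp: tree_pdist_def)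

lemma tree_pdist_triangle:
  assumes f: "continuous_on {0..1} f" and xyz: "x \<in> {0..1}" "y \<in> {0..1}" "z \<in> {0..1}"
  shows "tree_pdist f x z \<le> tree_pdist f x y + tree_pdist f y z"
proof -
  have "min (path_min f x y) (path_min f y z) \<le> path_min f x z"
    unfolding path_min_def[of f x z]
  proof (rule cInf_greatest)
    fix v assume "v \<in> f ` {min x z..max x z}"
    then obtain w where w: "w \<in> {min x z..max x z}" "v = f w" by auto
    then have "w \<in> {min x y..max x y} \<or> w \<in> {min y z..max y z}" by auto
    then show "min (path_min f x y) (path_min f y z) \<le> v"
      using path_min_le[OF f xyz(1,2)] path_min_le[OF f xyz(2,3)] w(2)
      by (auto simp: min_le_iff_disj)
  qed auto
  moreover have "path_min f x y \<le> f y" "path_min f y z \<le> f y"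
    using path_min_le[OF f xyz(1,2)] path_min_le[OF f xyz(2,3)] by auto
  ultimately show ?thesis
    unfolding tree_pdist_def min_le_iff_disj by linarith
qed

lemma equiv_tree_rel:
  assumes "continuous_on {0..1} f"
  shows "equiv {0..1} (tree_rel f)"
proof (rule equivI)
  show "trans (tree_rel f)"
  proof (rule transI)
    fix x y z assume "(x, y) \<in> tree_rel f" "(y, z) \<in> tree_rel f"
    then show "(x, z) \<in> tree_rel f"
      using tree_pdist_triangle[OF assms, of x y z] tree_pdist_ge[OF assms, of x z]
      by (auto simp: tree_rel_def)
  qed
qed (auto simp: tree_rel_def refl_on_def sym_def tree_pdist_refl tree_pdist_commute)

lemma treeE:
  assumes "\<tau> \<in> tree f"
  obtains x where "x \<in> {0..1}" "\<tau> = tree_rel f `` {x}"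
  using assms unfolding tree_def by (rule quotientE)

lemma tree_dist_class:
  assumes f: "continuous_on {0..1} f" and xy: "x \<in> {0..1}" "y \<in> {0..1}"
  shows "tree_dist f (tree_rel f `` {x}) (tree_rel f `` {y}) = tree_pdist f x y"
proof -
  have const: "tree_pdist f u v = tree_pdist f x y" if "(x, u) \<in> tree_rel f" "(y, v) \<in> tree_rel f" for u v
  proof -
    have uv: "u \<in> {0..1}" "v \<in> {0..1}" "tree_pdist f x u = 0" "tree_pdist f y v = 0"
      using that by (auto simp: tree_rel_def)
    note T = tree_pdist_triangle[OF f]
    show ?thesis
      using T[OF uv(1) xy(1) uv(2)] T[OF xy uv(2)] T[OF xy(1) uv(1) xy(2)] T[OF uv(1,2) xy(2)] uv(3,4)
        tree_pdist_commute[of f u x] tree_pdist_commute[of f v y]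
      by linarith
  qed
  have "(x, x) \<in> tree_rel f" "(y, y) \<in> tree_rel f"
    using xy by (auto simp: tree_rel_def tree_pdist_refl)
  then have ne: "(x, y) \<in> tree_rel f `` {x} \<times> tree_rel f `` {y}" by blast
  have "(\<lambda>(u, v). tree_pdist f u v) ` (tree_rel f `` {x} \<times> tree_rel f `` {y})
      = (\<lambda>_. tree_pdist f x y) ` (tree_rel f `` {x} \<times> tree_rel f `` {y})"
    by (intro image_cong refl) (clarsimp simp only: split_conv mem_Sigma_iff Image_singleton_iff const)
  also have "\<dots> = {tree_pdist f x y}"
    using ne by (simp only: image_constant)
  finally have "(\<lambda>(u, v). tree_pdist f u v) ` (tree_rel f `` {x} \<times> tree_rel f `` {y})
      = {tree_pdist f x y}" .
  then show ?thesis
    using xy by (simp add: tree_dist_def tree_def quotientI)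
qed

lemma tree_fun_class:
  assumes f: "continuous_on {0..1} f" and x: "x \<in> {0..1}"
  shows "tree_fun f (tree_rel f `` {x}) = f x"
proof -
  have const: "f u = f x" if "(x, u) \<in> tree_rel f" for u
  proof -
    have "u \<in> {0..1}" "tree_pdist f x u = 0"
      using that unfolding tree_rel_def by blast+
    then show ?thesis using tree_pdist_ge[OF f x, of u] by linarith
  qed
  have "(x, x) \<in> tree_rel f"
    using x by (simp add: tree_rel_def tree_pdist_refl)
  then have ne: "x \<in> tree_rel f `` {x}" by blast
  have "f ` (tree_rel f `` {x}) = (\<lambda>_. f x) ` (tree_rel f `` {x})"
    by (intro image_cong refl) (simp only: Image_singleton_iff const)
  also have "\<dots> = {f x}"
    using ne by (simp only: image_constant)
  finally show ?thesis by (simp add: tree_fun_def)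
qed

lemma Metric_space_tree:
  assumes f: "continuous_on {0..1} f"
  shows "Metric_space (tree f) (tree_dist f)"
proof
  fix \<sigma> \<tau>
  show "0 \<le> tree_dist f \<sigma> \<tau>"
  proof (cases "\<sigma> \<in> tree f \<and> \<tau> \<in> tree f")
    case True
    then obtain x y where "x \<in> {0..1}" "\<sigma> = tree_rel f `` {x}" "y \<in> {0..1}" "\<tau> = tree_rel f `` {y}"
      by (metis treeE)
    then show ?thesis
      using tree_dist_class[OF f, of x y] tree_pdist_ge[OF f, of x y] by auto
  qed (auto simp: tree_dist_def)
  show "tree_dist f \<sigma> \<tau> = tree_dist f \<tau> \<sigma>"
  proof (cases "\<sigma> \<in> tree f \<and> \<tau> \<in> tree f")
    case True
    then obtain x y where "x \<in> {0..1}" "\<sigma> = tree_rel f `` {x}" "y \<in> {0..1}" "\<tau> = tree_rel f `` {y}"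
      by (metis treeE)
    then show ?thesis
      by (simp add: tree_dist_class[OF f] tree_pdist_commute)
  qed (auto simp: tree_dist_def)
next
  fix \<sigma> \<tau> assume "\<sigma> \<in> tree f" "\<tau> \<in> tree f"
  then obtain x y where xy: "x \<in> {0..1}" "\<sigma> = tree_rel f `` {x}" "y \<in> {0..1}" "\<tau> = tree_rel f `` {y}"
    by (metis treeE)
  then have "\<sigma> = \<tau> \<longleftrightarrow> (x, y) \<in> tree_rel f"
    using eq_equiv_class_iff[OF equiv_tree_rel[OF f]] by blast
  also have "\<dots> \<longleftrightarrow> tree_pdist f x y = 0"
    using xy by (auto simp: tree_rel_def)
  finally show "tree_dist f \<sigma> \<tau> = 0 \<longleftrightarrow> \<sigma> = \<tau>"
    using xy tree_dist_class[OF f] by simp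
next
  fix \<sigma> \<tau> \<rho> assume "\<sigma> \<in> tree f" "\<tau> \<in> tree f" "\<rho> \<in> tree f"
  then obtain x y z where "x \<in> {0..1}" "\<sigma> = tree_rel f `` {x}" "y \<in> {0..1}" "\<tau> = tree_rel f `` {y}"
      "z \<in> {0..1}" "\<rho> = tree_rel f `` {z}"
    by (metis treeE)
  then show "tree_dist f \<sigma> \<rho> \<le> tree_dist f \<sigma> \<tau> + tree_dist f \<tau> \<rho>"
    using tree_pdist_triangle[OF f, of x y z] by (simp add: tree_dist_class[OF f])
qed

lemma tree_root_unique:
  assumes f: "continuous_on {0..1} f"
  shows "\<exists>!\<tau>. \<tau> \<in> tree f \<and> (\<exists>x\<in>\<tau>. \<forall>y\<in>{0..1}. f x \<le> f y)"
proof -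
  note eq = equiv_tree_rel[OF f]
  obtain m where m: "m \<in> {0..1}" "\<forall>y\<in>{0..1}. f m \<le> f y"
    using continuous_attains_inf[OF compact_Icc _ f] by auto
  show ?thesis
  proof (rule ex1I)
    show "tree_rel f `` {m} \<in> tree f \<and> (\<exists>x\<in>tree_rel f `` {m}. \<forall>y\<in>{0..1}. f x \<le> f y)"
      using m equiv_class_self[OF eq m(1)] by (auto simp: tree_def quotientI)
  next
    fix \<tau> assume \<tau>: "\<tau> \<in> tree f \<and> (\<exists>x\<in>\<tau>. \<forall>y\<in>{0..1}. f x \<le> f y)"
    then obtain x where x: "x \<in> \<tau>" "\<forall>y\<in>{0..1}. f x \<le> f y" by blast
    obtain z where z: "z \<in> {0..1}" "\<tau> = tree_rel f `` {z}" using \<tau> by (metis treeE)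
    have zx: "(z, x) \<in> tree_rel f" and x01: "x \<in> {0..1}"
      using x(1) z by (auto simp: tree_rel_def)
    have fxm: "f x = f m" using x(2) m x01 by (meson order_antisym)
    have "f m \<le> path_min f m x"
      unfolding path_min_def
    proof (rule cInf_greatest)
      fix v assume "v \<in> f ` {min m x..max m x}"
      then obtain w where w: "v = f w" "w \<in> {min m x..max m x}" by blast
      then have "w \<in> {0..1}" using m(1) x01 by (auto simp: min_le_iff_disj le_max_iff_disj)
      then show "f m \<le> v" using m(2) w(1) by blast
    qed auto
    moreover have "path_min f m x \<le> f m"
      by (rule path_min_le[OF f m(1) x01]) auto
    ultimately have "(m, x) \<in> tree_rel f"
      using m(1) x01 fxm by (auto simp: tree_rel_def tree_pdist_def)
    then show "\<tau> = tree_rel f `` {m}"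
      using z(2) zx equiv_class_eq[OF eq] by metis
  qed
qed

end

theory Submission
  imports Defs
begin

text \<open>
  Where the height \<open>h\<close> is positive, the power \<open>p - 1\<close> of \<open>h\<close> is the product of its powers
  \<open>(p\<^sub>0 - 1) (1 - \<theta>)\<close> and \<open>(p\<^sub>1 - 1) \<theta>\<close>, and the claim is the Hoelder inequality. The set \<open>h = 0\<close> may have
  positive measure; if \<open>p\<^sub>0 < 1\<close>, the right-hand side is then infinite, because \<open>h\<close> is positive
  on the geodesic from the root to the maximum of \<open>f\<close>, except at its upper end, and this geodesic has
  positive length unless the tree is a single point, hence null. If \<open>p\<^sub>0 \<ge> 1\<close>, then \<open>p > 1\<close> and the
  left-hand integrand vanishes where \<open>h = 0\<close>.

  The height is Borel because the supremum of \<open>f\<close> above \<open>\<tau>\<close> is larger than \<open>a\<close> if and only if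
  \<open>f \<tau> > a\<close> or \<open>\<tau>\<close> lies in one of countably many closed sets \<open>f \<tau> + d \<tau> [q] = f q\<close>
  with \<open>q\<close> rational and \<open>f q > a\<close>.
\<close>

section \<open>Ancestors\<close>

text \<open>For continuous \<open>f\<close> this is the order of the tree read off representatives:
  the class of \<open>x\<close> lies on a geodesic from the root to the class of
  \<open>y\<close>.\<close>

definition ancestor :: "(real \<Rightarrow> real) \<Rightarrow> real \<Rightarrow> real \<Rightarrow> bool" where
  "ancestor f x y \<longleftrightarrow> (\<forall>z\<in>{min x y..max x y}. f x \<le> f z)"

lemma ancestor_refl [simp]: "ancestor f x x"
  by (simp add: ancestor_def)

lemma ancestor_minimum:
  assumes "\<forall>z\<in>{0..1}. f r \<le> f z" "r \<in> {0..1}" "y \<in> {0..1}"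
  shows "ancestor f r y"
proof -
  have "{min r y..max r y} \<subseteq> {0..1}"
    using assms(2,3) by auto
  then show ?thesis
    using assms(1) unfolding ancestor_def by blast
qed

lemma path_min_eqI:
  assumes "z \<in> {min x y..max x y}" "\<And>w. w \<in> {min x y..max x y} \<Longrightarrow> f z \<le> f w"
  shows "path_min f x y = f z"
  unfolding path_min_def using assms by (intro cInf_eq_minimum) auto

text \<open>The path between \<open>x\<close> and \<open>x'\<close> is covered by the paths from
  each of them to \<open>y\<close>, on which \<open>f\<close> is at least \<open>f x\<close>. Hence
  the ancestors of \<open>y\<close> form a chain, with distances given by the values of
  \<open>f\<close>.\<close>

lemma tree_pdist_ancestors:
  assumes "ancestor f x y" "ancestor f x' y" "f x \<le> f x'"
  shows "tree_pdist f x x' = f x' - f x"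
proof -
  have "path_min f x x' = f x"
  proof (rule path_min_eqI)
    fix w assume w: "w \<in> {min x x'..max x x'}"
    then have "w \<in> {min x y..max x y} \<or> w \<in> {min x' y..max x' y}"
      by auto
    then show "f x \<le> f w"
      using assms unfolding ancestor_def by (meson order_trans)
  qed auto
  then show ?thesis by (simp add: tree_pdist_def)
qed

text \<open>Both sides say that the minimum of \<open>f\<close> over the path is \<open>f x\<close>.
  The metric side depends only on the classes of \<open>x\<close> and \<open>y\<close>, which
  carries the order over to the tree and later makes it measurable.\<close>

lemma ancestor_iff_tree_pdist:
  assumes "continuous_on {0..1} f" "x \<in> {0..1}" "y \<in> {0..1}"
  shows "ancestor f x y \<longleftrightarrow> tree_pdist f x y = f y - f x"
proof
  assume "ancestor f x y"
  moreover have "f x \<le> f y"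
    using calculation by (auto simp: ancestor_def)
  ultimately show "tree_pdist f x y = f y - f x"
    by (intro tree_pdist_ancestors) auto
next
  assume "tree_pdist f x y = f y - f x"
  then have "path_min f x y = f x"
    by (simp add: tree_pdist_def)
  then show "ancestor f x y"
    using path_min_le[OF assms] by (auto simp: ancestor_def)
qed

text \<open>Of the points between \<open>r\<close> and \<open>y\<close> at level \<open>s\<close>,
  take the one nearest to \<open>y\<close>. If \<open>f\<close> fell below \<open>s\<close> between
  it and \<open>y\<close>, the intermediate value theorem would give a nearer point at level
  \<open>s\<close>.\<close>

lemma ancestor_at_level:
  fixes f :: "real \<Rightarrow> real"
  assumes f: "continuous_on {0..1} f" and ry: "r \<in> {0..1}" "y \<in> {0..1}" and s: "f r \<le> s" "s \<le> f y"
  shows "\<exists>x\<in>{0..1}. f x = s \<and> ancestor f x y"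
proof -
  define A where "A = {z \<in> closed_segment r y. f z = s}"
  have sub: "closed_segment r y \<subseteq> {0..1}"
    using ry by (auto simp: closed_segment_eq_real_ivl)
  then have cont: "continuous_on (closed_segment r y) f"
    using f continuous_on_subset by blast
  have "\<exists>x\<in>closed_segment r y. f x = s"
    by (rule IVT'_closed_segment_real[OF _ cont]) (use s in \<open>auto simp: closed_segment_eq_real_ivl\<close>)
  then have ne: "A \<noteq> {}"
    by (auto simp: A_def)
  have "closed A"
    unfolding A_def by (rule continuous_closed_preimage_constant[OF cont closed_segment])
  moreover have "bounded A"
    by (rule bounded_subset[OF bounded_closed_segment]) (auto simp: A_def)
  ultimately have "compact A"
    by (simp add: compact_eq_bounded_closed)
  moreover have "continuous_on A (\<lambda>z. \<bar>z - y\<bar>)"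
    by (intro continuous_intros)
  ultimately obtain x where x: "x \<in> A" "\<And>z. z \<in> A \<Longrightarrow> \<bar>x - y\<bar> \<le> \<bar>z - y\<bar>"
    using continuous_attains_inf[OF _ ne] by blast
  have "s \<le> f z" if z: "z \<in> {min x y..max x y}" for z
  proof (rule ccontr)
    assume "\<not> s \<le> f z"
    have zy: "closed_segment z y \<subseteq> closed_segment r y"
      using z x(1) unfolding A_def
      by (auto simp: closed_segment_eq_real_ivl split: if_splits)
    have "\<exists>w\<in>closed_segment z y. f w = s"
      by (rule IVT'_closed_segment_real[OF _ continuous_on_subset[OF cont zy]])
        (use \<open>\<not> s \<le> f z\<close> s in \<open>auto simp: closed_segment_eq_real_ivl\<close>)
    then obtain w where w: "w \<in> closed_segment z y" "f w = s"
      by blast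
    then have "\<bar>x - y\<bar> \<le> \<bar>w - y\<bar>"
      using x(2) zy by (auto simp: A_def)
    moreover have "w \<noteq> z"
      using w \<open>\<not> s \<le> f z\<close> by auto
    ultimately show False
      using w(1) z by (auto simp: closed_segment_eq_real_ivl split: if_splits)
  qed
  then show ?thesis
    using x(1) sub by (auto simp: A_def ancestor_def)
qed

section \<open>Geodesics from the root and the points above a given point\<close>

lemma class_in_tree: "x \<in> {0..1} \<Longrightarrow> tree_rel f `` {x} \<in> tree f"
  by (simp add: tree_def quotientI)

lemma class_eqI:
  assumes "continuous_on {0..1} f" "x \<in> {0..1}" "y \<in> {0..1}" "tree_pdist f x y = 0"
  shows "tree_rel f `` {x} = tree_rel f `` {y}"
  by (rule equiv_class_eq[OF equiv_tree_rel[OF assms(1)]]) (use assms in \<open>auto simp: tree_rel_def\<close>)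

lemma tree_root_class:
  assumes f: "continuous_on {0..1} f" and r: "r \<in> {0..1}" "\<forall>z\<in>{0..1}. f r \<le> f z"
  shows "tree_root f = tree_rel f `` {r}"
  unfolding tree_root_def
proof (rule the1_equality[OF tree_root_unique[OF f]])
  show "tree_rel f `` {r} \<in> tree f \<and> (\<exists>x\<in>tree_rel f `` {r}. \<forall>y\<in>{0..1}. f x \<le> f y)"
    using r equiv_class_self[OF equiv_tree_rel[OF f] r(1)] class_in_tree by blast
qed

text \<open>The geodesic sends \<open>t\<close> to the class of an ancestor of \<open>y\<close> at
  level \<open>f r + t\<close>; it is isometric because ancestors of \<open>y\<close> form a
  chain.\<close>

lemma geodesic_segment_root:
  assumes f: "continuous_on {0..1} f" and r: "r \<in> {0..1}" "\<forall>z\<in>{0..1}. f r \<le> f z"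
    and xy: "x \<in> {0..1}" "y \<in> {0..1}" "ancestor f x y"
  shows "\<exists>S. geodesic_segment (tree f) (tree_dist f) (tree_root f) (tree_rel f `` {y}) S
           \<and> tree_rel f `` {x} \<in> S"
proof -
  let ?cl = "\<lambda>x. tree_rel f `` {x}"
  define D where "D = f y - f r"
  have "ancestor f r y"
    using ancestor_minimum r xy by blast
  then have D: "tree_dist f (tree_root f) (?cl y) = D"
    using f r xy by (simp add: tree_root_class tree_dist_class ancestor_iff_tree_pdist D_def)
  have D0: "0 \<le> D"
    using r xy by (simp add: D_def)
  have "\<forall>t\<in>{0..D}. \<exists>u\<in>{0..1}. f u = f r + t \<and> ancestor f u y"
    using ancestor_at_level[OF f r(1) xy(2)] by (auto simp: D_def)
  then obtain c where c: "\<And>t. t \<in> {0..D} \<Longrightarrow> c t \<in> {0..1} \<and> f (c t) = f r + t \<and> ancestor f (c t) y"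
    by metis
  \<comment> \<open>The choice \<open>c\<close> is arbitrary, but two ancestors of \<open>y\<close>
    at the same level are at pseudo-distance 0, so the classes do not depend on it and the curve
    meets the class of every ancestor.\<close>
  have on_level: "?cl (c (f u - f r)) = ?cl u" if "u \<in> {0..1}" "ancestor f u y" for u
  proof -
    have "f u \<le> f y"
      using that by (auto simp: ancestor_def)
    then have "f u - f r \<in> {0..D}"
      using r that by (auto simp: D_def)
    then show ?thesis
      using c[of "f u - f r"] that by (intro class_eqI[OF f]) (auto simp: tree_pdist_ancestors[where y = y])
  qed
  have dist: "tree_dist f (?cl (c s)) (?cl (c t)) = \<bar>s - t\<bar>" if "s \<in> {0..D}" "t \<in> {0..D}" for s t
  proof (cases "s \<le> t")
    case True
    then show ?thesis
      using c[OF that(1)] c[OF that(2)] tree_pdist_ancestors[of f "c s" y "c t"]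
      by (auto simp: tree_dist_class[OF f])
  next
    case False
    then show ?thesis
      using c[OF that(1)] c[OF that(2)] tree_pdist_ancestors[of f "c t" y "c s"]
      by (auto simp: tree_dist_class[OF f] tree_pdist_commute[of f "c s"])
  qed
  have "geodesic_segment (tree f) (tree_dist f) (tree_root f) (?cl y) ((\<lambda>t. ?cl (c t)) ` {0..D})"
    unfolding geodesic_segment_def D
  proof (intro exI[of _ "\<lambda>t. ?cl (c t)"] conjI ballI)
    show "(\<lambda>t. ?cl (c t)) \<in> {0..D} \<rightarrow> tree f"
      using c class_in_tree by blast
    show "?cl (c 0) = tree_root f"
      using on_level[OF r(1) \<open>ancestor f r y\<close>] tree_root_class[OF f r] by simp
    show "?cl (c D) = ?cl y"
      using on_level[OF xy(2)] by (simp add: D_def)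
  qed (use dist in auto)
  moreover have "?cl x \<in> (\<lambda>t. ?cl (c t)) ` {0..D}"
  proof
    show "?cl x = ?cl (c (f x - f r))"
      using on_level xy by simp
    show "f x - f r \<in> {0..D}"
      using r xy by (auto simp: D_def ancestor_def)
  qed
  ultimately show ?thesis by blast
qed

text \<open>The point at parameter \<open>t\<close> of a geodesic of length \<open>D\<close> has
  distance \<open>t\<close> from the root and \<open>D - t\<close> from the end. Distance from the
  root is \<open>f\<close> minus its minimum, so the distance from \<open>x\<close> to
  \<open>y\<close> is \<open>f y - f x\<close>. Any geodesic \<open>S\<close> is allowed, since
  \<open>tree_above\<close> only asks that one exists.\<close>

lemma geodesic_segment_root_imp_ancestor:
  assumes f: "continuous_on {0..1} f" and xy: "x \<in> {0..1}" "y \<in> {0..1}"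
    and S: "geodesic_segment (tree f) (tree_dist f) (tree_root f) (tree_rel f `` {y}) S"
      "tree_rel f `` {x} \<in> S"
  shows "ancestor f x y"
proof -
  obtain r where r: "r \<in> {0..1}" "\<forall>z\<in>{0..1}. f r \<le> f z"
    using continuous_attains_inf[OF compact_Icc _ f] by auto
  have root: "tree_dist f (tree_root f) (tree_rel f `` {u}) = f u - f r" if "u \<in> {0..1}" for u
    using ancestor_minimum[OF r(2,1) that] that f r
    by (simp add: tree_root_class tree_dist_class ancestor_iff_tree_pdist)
  define D where "D = f y - f r"
  have D: "0 \<le> D"
    using r xy by (simp add: D_def)
  obtain g where g: "g 0 = tree_root f" "g D = tree_rel f `` {y}"
      "\<forall>s\<in>{0..D}. \<forall>t\<in>{0..D}. tree_dist f (g s) (g t) = \<bar>s - t\<bar>" "S = g ` {0..D}"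
    using S(1) unfolding geodesic_segment_def root[OF xy(2)] D_def[symmetric] by blast
  then obtain t where t: "t \<in> {0..D}" "tree_rel f `` {x} = g t"
    using S(2) by blast
  have "f x - f r = t"
    using root[OF xy(1)] g(1) g(3)[rule_format, of 0 t] t D by simp
  moreover have "tree_dist f (tree_rel f `` {x}) (tree_rel f `` {y}) = D - t"
    using g(2) g(3)[rule_format, of t D] t D by simp
  ultimately have "tree_pdist f x y = f y - f x"
    using tree_dist_class[OF f xy] by (simp add: D_def)
  then show ?thesis
    using ancestor_iff_tree_pdist[OF f xy] by simp
qed

lemma tree_above_class:
  assumes f: "continuous_on {0..1} f" and x: "x \<in> {0..1}"
  shows "tree_above f (tree_rel f `` {x}) = (\<lambda>y. tree_rel f `` {y}) ` {y\<in>{0..1}. ancestor f x y}"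
proof -
  obtain r where r: "r \<in> {0..1}" "\<forall>z\<in>{0..1}. f r \<le> f z"
    using continuous_attains_inf[OF compact_Icc _ f] by auto
  show ?thesis
  proof (intro equalityI subsetI)
    fix \<tau> assume \<tau>: "\<tau> \<in> tree_above f (tree_rel f `` {x})"
    then have "\<tau> \<in> tree f"
      by (simp add: tree_above_def)
    then obtain y where y: "y \<in> {0..1}" "\<tau> = tree_rel f `` {y}"
      by (rule treeE)
    with \<tau> have "ancestor f x y"
      using geodesic_segment_root_imp_ancestor[OF f x y(1)] by (auto simp: tree_above_def)
    with y show "\<tau> \<in> (\<lambda>y. tree_rel f `` {y}) ` {y\<in>{0..1}. ancestor f x y}"
      by blast
  next
    fix \<tau> assume "\<tau> \<in> (\<lambda>y. tree_rel f `` {y}) ` {y\<in>{0..1}. ancestor f x y}"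
    then show "\<tau> \<in> tree_above f (tree_rel f `` {x})"
      using geodesic_segment_root[OF f r x] class_in_tree by (auto simp: tree_above_def)
  qed
qed

section \<open>Measurability of the height\<close>

definition tree_sup :: "(real \<Rightarrow> real) \<Rightarrow> real set \<Rightarrow> real" where
  "tree_sup f \<tau> = Sup (tree_fun f ` tree_above f \<tau>)"

lemma tree_height_eq: "tree_height f \<tau> = tree_sup f \<tau> - tree_fun f \<tau>"
  by (simp add: tree_height_def tree_sup_def)

lemma tree_sup_class:
  assumes f: "continuous_on {0..1} f" and x: "x \<in> {0..1}"
  shows "tree_sup f (tree_rel f `` {x}) = Sup (f ` {y\<in>{0..1}. ancestor f x y})"
  unfolding tree_sup_def tree_above_class[OF assms] image_image
  by (intro arg_cong[where f = Sup] image_cong refl) (use tree_fun_class[OF f] in blast)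

lemma bdd_above_ancestor_image:
  fixes f :: "real \<Rightarrow> real"
  assumes "continuous_on {0..1} f"
  shows "bdd_above (f ` {y\<in>{0..1}. ancestor f x y})"
proof -
  have "bdd_above (f ` {0..1})"
    using assms by (intro bounded_imp_bdd_above compact_imp_bounded compact_continuous_image) auto
  then show ?thesis
    by (rule bdd_above_mono) auto
qed

lemma le_tree_sup:
  assumes f: "continuous_on {0..1} f" and "x \<in> {0..1}" "y \<in> {0..1}" "ancestor f x y"
  shows "f y \<le> tree_sup f (tree_rel f `` {x})"
  unfolding tree_sup_class[OF assms(1,2)]
  using assms by (intro cSup_upper bdd_above_ancestor_image[OF f]) auto

text \<open>Rational witnesses make the supremum a countable condition. A witness \<open>y\<close>
  other than \<open>x\<close> is replaced by a rational \<open>q\<close> strictly between them,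
  close enough to \<open>y\<close> that \<open>a < f q\<close>; \<open>x\<close> remains an ancestor
  on the shorter path. The alternative \<open>a < f x\<close> covers the witness
  \<open>y = x\<close>.\<close>

lemma less_tree_sup_iff:
  assumes f: "continuous_on {0..1} f" and x: "x \<in> {0..1}"
  shows "a < tree_sup f (tree_rel f `` {x}) \<longleftrightarrow>
    a < f x \<or> (\<exists>q\<in>\<rat> \<inter> {0..1}. a < f q \<and> ancestor f x q)" (is "_ \<longleftrightarrow> ?R")
proof
  assume "a < tree_sup f (tree_rel f `` {x})"
  moreover have "f ` {y\<in>{0..1}. ancestor f x y} \<noteq> {}"
    using x ancestor_refl by blast
  ultimately have "\<exists>v\<in>f ` {y\<in>{0..1}. ancestor f x y}. a < v"
    by (simp only: tree_sup_class[OF assms] less_cSup_iff[OF _ bdd_above_ancestor_image[OF f]] not_False_eq_True)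
  then obtain y where y: "y \<in> {0..1}" "ancestor f x y" "a < f y"
    by blast
  show ?R
  proof (cases "x = y")
    case False
    have "continuous (at y within {0..1}) f"
      using f y by (simp add: continuous_on_eq_continuous_within)
    then have "\<forall>\<^sub>F z in at y within {0..1}. a < f z"
      using y(3) by (auto simp: continuous_within intro: order_tendstoD)
    then obtain e where e: "e > 0" "\<And>z. z \<in> {0..1} \<Longrightarrow> z \<noteq> y \<Longrightarrow> dist z y < e \<Longrightarrow> a < f z"
      by (auto simp: eventually_at)
    have "\<exists>q\<in>\<rat>. q \<in> {min x y<..<max x y} \<and> \<bar>q - y\<bar> < e"
    proof (cases "x < y")
      case True
      then obtain q where "q \<in> \<rat>" "max x (y - e) < q" "q < y"
        using Rats_dense_in_real[of "max x (y - e)" y] e(1) by auto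
      then show ?thesis using True by (intro bexI[of _ q]) auto
    next
      case nless: False
      then obtain q where "q \<in> \<rat>" "y < q" "q < min x (y + e)"
        using Rats_dense_in_real[of y "min x (y + e)"] e(1) False by auto
      then show ?thesis using nless by (intro bexI[of _ q]) auto
    qed
    then obtain q where q: "q \<in> \<rat>" "q \<in> {min x y<..<max x y}" "\<bar>q - y\<bar> < e"
      by blast
    have "q \<in> {0..1}"
      using q(2) x y(1) by auto
    moreover have "a < f q"
      using q e(2)[OF calculation] by (auto simp: dist_real_def)
    moreover have "ancestor f x q"
    proof -
      have "{min x q..max x q} \<subseteq> {min x y..max x y}"
        using q(2) by auto
      then show ?thesis
        using y(2) unfolding ancestor_def by blast
    qed
    ultimately show ?thesis
      using q(1) by blast
  qed (use y in auto)
next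
  assume ?R
  then show "a < tree_sup f (tree_rel f `` {x})"
    using le_tree_sup[OF f x] x by (auto intro: less_le_trans)
qed

text \<open>Strict superlevel sets are open: the ball of radius \<open>g \<sigma> - a\<close> about
  \<open>\<sigma>\<close> stays inside.\<close>

lemma borel_measurable_tree_Lipschitz:
  assumes f: "continuous_on {0..1} f" and L: "length_measure f \<Lambda>"
    and g: "\<And>\<sigma> \<tau>. \<sigma> \<in> tree f \<Longrightarrow> \<tau> \<in> tree f \<Longrightarrow> \<bar>g \<sigma> - g \<tau>\<bar> \<le> tree_dist f \<sigma> \<tau>"
  shows "g \<in> borel_measurable \<Lambda>"
proof (rule borel_measurableI_greater)
  interpret T: Metric_space "tree f" "tree_dist f"
    by (rule Metric_space_tree[OF f])
  fix a :: real
  have "openin T.mtopology {\<tau>\<in>tree f. a < g \<tau>}"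
    unfolding T.openin_mtopology
  proof (intro conjI allI impI)
    fix \<sigma> assume \<sigma>: "\<sigma> \<in> {\<tau>\<in>tree f. a < g \<tau>}"
    have "T.mball \<sigma> (g \<sigma> - a) \<subseteq> {\<tau>\<in>tree f. a < g \<tau>}"
    proof
      fix \<tau> assume "\<tau> \<in> T.mball \<sigma> (g \<sigma> - a)"
      then show "\<tau> \<in> {\<tau>\<in>tree f. a < g \<tau>}"
        using g[of \<sigma> \<tau>] by (auto simp: T.in_mball)
    qed
    then show "\<exists>r>0. T.mball \<sigma> r \<subseteq> {\<tau>\<in>tree f. a < g \<tau>}"
      using \<sigma> by (intro exI[of _ "g \<sigma> - a"]) auto
  qed auto
  then show "{\<tau>\<in>space \<Lambda>. a < g \<tau>} \<in> sets \<Lambda>"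
    using L by (auto simp: length_measure_def)
qed

lemma borel_measurable_tree_fun:
  assumes f: "continuous_on {0..1} f" and L: "length_measure f \<Lambda>"
  shows "tree_fun f \<in> borel_measurable \<Lambda>"
proof (rule borel_measurable_tree_Lipschitz[OF assms])
  fix \<sigma> \<tau> assume "\<sigma> \<in> tree f" "\<tau> \<in> tree f"
  then obtain x y where "x \<in> {0..1}" "\<sigma> = tree_rel f `` {x}" "y \<in> {0..1}" "\<tau> = tree_rel f `` {y}"
    by (metis treeE)
  then show "\<bar>tree_fun f \<sigma> - tree_fun f \<tau>\<bar> \<le> tree_dist f \<sigma> \<tau>"
    using tree_pdist_ge[OF f] by (simp add: tree_fun_class[OF f] tree_dist_class[OF f])
qed

lemma borel_measurable_tree_dist:
  assumes f: "continuous_on {0..1} f" and L: "length_measure f \<Lambda>" and "\<rho> \<in> tree f"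
  shows "(\<lambda>\<tau>. tree_dist f \<tau> \<rho>) \<in> borel_measurable \<Lambda>"
proof (rule borel_measurable_tree_Lipschitz[OF assms(1,2)])
  interpret T: Metric_space "tree f" "tree_dist f"
    by (rule Metric_space_tree[OF f])
  fix \<sigma> \<tau> assume "\<sigma> \<in> tree f" "\<tau> \<in> tree f"
  then show "\<bar>tree_dist f \<sigma> \<rho> - tree_dist f \<tau> \<rho>\<bar> \<le> tree_dist f \<sigma> \<tau>"
    using T.triangle[of \<sigma> \<tau> \<rho>] T.triangle[of \<tau> \<sigma> \<rho>] T.commute[of \<sigma> \<tau>] assms(3) by auto
qed

lemma borel_measurable_tree_height:
  assumes f: "continuous_on {0..1} f" and L: "length_measure f \<Lambda>"
  shows "tree_height f \<in> borel_measurable \<Lambda>"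
proof -
  note [measurable] = borel_measurable_tree_fun[OF assms]
  have space: "space \<Lambda> = tree f"
    using L by (simp add: length_measure_def)
  have "tree_sup f \<in> borel_measurable \<Lambda>"
  proof (rule borel_measurableI_greater)
    fix a :: real
    define Q where "Q = {q\<in>\<rat> \<inter> {0..1}. a < f q}"
    have "countable Q"
      unfolding Q_def by (rule countable_subset[OF _ countable_rat]) auto
    have "a < tree_sup f \<tau> \<longleftrightarrow> a < tree_fun f \<tau> \<or>
      (\<exists>q\<in>Q. tree_fun f \<tau> + tree_dist f \<tau> (tree_rel f `` {q}) = f q)" if "\<tau> \<in> tree f" for \<tau>
      using that
    proof (rule treeE)
      fix x assume x: "x \<in> {0..1}" "\<tau> = tree_rel f `` {x}"
      have "ancestor f x q \<longleftrightarrow> tree_fun f \<tau> + tree_dist f \<tau> (tree_rel f `` {q}) = f q"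
        if "q \<in> {0..1}" for q
        using x that ancestor_iff_tree_pdist[OF f x(1) that]
        by (auto simp: tree_fun_class[OF f] tree_dist_class[OF f])
      then show ?thesis
        using less_tree_sup_iff[OF f x(1), of a] x by (auto simp: tree_fun_class[OF f] Q_def)
    qed
    then have "{\<tau>\<in>space \<Lambda>. a < tree_sup f \<tau>} = {\<tau>\<in>space \<Lambda>. a < tree_fun f \<tau>} \<union>
      (\<Union>q\<in>Q. {\<tau>\<in>space \<Lambda>. tree_fun f \<tau> + tree_dist f \<tau> (tree_rel f `` {q}) = f q})"
      by (auto simp: space)
    also have "\<dots> \<in> sets \<Lambda>"
    proof (intro sets.Un sets.countable_UN''[OF \<open>countable Q\<close>])
      fix q assume "q \<in> Q"
      then have [measurable]: "(\<lambda>\<tau>. tree_dist f \<tau> (tree_rel f `` {q})) \<in> borel_measurable \<Lambda>"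
        by (intro borel_measurable_tree_dist[OF assms] class_in_tree) (auto simp: Q_def)
      show "{\<tau>\<in>space \<Lambda>. tree_fun f \<tau> + tree_dist f \<tau> (tree_rel f `` {q}) = f q} \<in> sets \<Lambda>"
        by measurable
    qed measurable
    finally show "{\<tau>\<in>space \<Lambda>. a < tree_sup f \<tau>} \<in> sets \<Lambda>" .
  qed
  then show ?thesis
    unfolding tree_height_eq[abs_def] by measurable
qed

section \<open>Trees whose height vanishes almost everywhere\<close>

text \<open>Used in contrapositive form: on a tree of positive measure the height is positive on a
  set of positive measure, which keeps the right-hand side of the interpolation from being infinity
  times 0.\<close>

lemma null_tree_if_null_height:
  assumes f: "continuous_on {0..1} f" and L: "length_measure f \<Lambda>"
    and null: "emeasure \<Lambda> {\<tau>\<in>space \<Lambda>. 0 < tree_height f \<tau>} = 0"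
  shows "emeasure \<Lambda> (space \<Lambda>) = 0"
proof -
  note [measurable] = borel_measurable_tree_height[OF f L]
  have space: "space \<Lambda> = tree f"
    using L by (simp add: length_measure_def)
  obtain r where r: "r \<in> {0..1}" "\<forall>z\<in>{0..1}. f r \<le> f z"
    using continuous_attains_inf[OF compact_Icc _ f] by auto
  obtain m where m: "m \<in> {0..1}" "\<forall>z\<in>{0..1}. f z \<le> f m"
    using continuous_attains_sup[OF compact_Icc _ f] by auto
  let ?m = "tree_rel f `` {m}"
  have m_tree: "?m \<in> tree f"
    using m class_in_tree by blast
  obtain S where S: "geodesic_segment (tree f) (tree_dist f) (tree_root f) ?m S"
    using geodesic_segment_root[OF f r r(1) m(1) ancestor_minimum[OF r(2,1) m(1)]] by blast
  \<comment> \<open>\<open>emeasure\<close> is 0 on nonmeasurable sets by default, so the value 0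
    alone does not make the point a null set. It is Borel because points of a metric space are
    closed.\<close>
  have null_m: "{?m} \<in> null_sets \<Lambda>"
  proof -
    have "closedin (Metric_space.mtopology (tree f) (tree_dist f)) {?m}"
      using m_tree Hausdorff_imp_t1_space[OF Metric_space.Hausdorff_space_mtopology[OF Metric_space_tree[OF f]]]
        Metric_space.topspace_mtopology[OF Metric_space_tree[OF f]]
      by (simp add: closedin_t1_singleton)
    then have "tree f - {?m} \<in> sets \<Lambda>"
      using L Metric_space.topspace_mtopology[OF Metric_space_tree[OF f]]
      by (auto simp: length_measure_def closedin_def)
    then have "space \<Lambda> - (tree f - {?m}) \<in> sets \<Lambda>"
      by blast
    moreover have "space \<Lambda> - (tree f - {?m}) = {?m}"
      using m_tree space by auto
    ultimately show ?thesis
      using L m_tree by (auto simp: length_measure_def null_sets_def)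
  qed
  have "S \<subseteq> {\<tau>\<in>space \<Lambda>. 0 < tree_height f \<tau>} \<union> {?m}"
  proof
    fix \<tau> assume "\<tau> \<in> S"
    then have \<tau>: "\<tau> \<in> tree f"
      using S by (auto simp: geodesic_segment_def)
    then obtain x where x: "x \<in> {0..1}" "\<tau> = tree_rel f `` {x}"
      by (rule treeE)
    then have anc: "ancestor f x m"
      using geodesic_segment_root_imp_ancestor[OF f x(1) m(1) S] \<open>\<tau> \<in> S\<close> by blast
    show "\<tau> \<in> {\<tau>\<in>space \<Lambda>. 0 < tree_height f \<tau>} \<union> {?m}"
    proof (cases "f x = f m")
      case True
      then have "\<tau> = ?m"
        using class_eqI[OF f x(1) m(1)] x anc ancestor_iff_tree_pdist[OF f x(1) m(1)] by simp
      then show ?thesis by simp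
    next
      case False
      then have "f x < f m"
        using m x by (simp add: order_less_le)
      then have "0 < tree_height f \<tau>"
        using le_tree_sup[OF f x(1) m(1) anc] x(2) tree_fun_class[OF f x(1)] by (simp add: tree_height_eq)
      then show ?thesis
        using \<tau> space by simp
    qed
  qed
  \<comment> \<open>Monotonicity of \<open>emeasure\<close> asks for measurability of the larger
    set, so it is the union that is shown to be a null set.\<close>
  moreover have null_Un: "{\<tau>\<in>space \<Lambda>. 0 < tree_height f \<tau>} \<union> {?m} \<in> null_sets \<Lambda>"
    by (rule null_sets.Un[OF null_setsI[OF null] null_m]) measurable
  ultimately have "emeasure \<Lambda> S \<le> emeasure \<Lambda> ({\<tau>\<in>space \<Lambda>. 0 < tree_height f \<tau>} \<union> {?m})"
    by (intro emeasure_mono null_setsD2)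
  then have "emeasure \<Lambda> S \<le> 0"
    by (simp only: null_setsD1[OF null_Un])
  moreover have "tree_root f \<in> tree f"
    using tree_root_class[OF f r] class_in_tree[OF r(1)] by simp
  then have "emeasure \<Lambda> S = ennreal (tree_dist f (tree_root f) ?m)"
    using L S m_tree unfolding length_measure_def by blast
  moreover have "tree_dist f (tree_root f) ?m = f m - f r"
    using ancestor_minimum[OF r(2,1) m(1)] r m f
    by (simp add: tree_root_class tree_dist_class ancestor_iff_tree_pdist)
  \<comment> \<open>The geodesic has length 0, so the maximum of \<open>f\<close> is at most its
    minimum; then \<open>f\<close> is constant and the tree is the single class of
    \<open>m\<close>.\<close>
  ultimately have "f m \<le> f r"
    by (simp add: ennreal_eq_0_iff)
  then have const: "f z = f m" if "z \<in> {0..1}" for z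
    using r m that by (meson order_antisym order_trans)
  have "tree f \<subseteq> {?m}"
  proof
    fix \<tau> assume "\<tau> \<in> tree f"
    then obtain x where x: "x \<in> {0..1}" "\<tau> = tree_rel f `` {x}"
      by (rule treeE)
    have "ancestor f x m"
    proof (rule ancestor_minimum[OF _ x(1) m(1)], rule ballI)
      show "f x \<le> f z" if "z \<in> {0..1}" for z
        unfolding const[OF x(1)] const[OF that] by (rule order_refl)
    qed
    then have "tree_pdist f x m = 0"
      using ancestor_iff_tree_pdist[OF f x(1) m(1)] const[OF x(1)] by simp
    then show "\<tau> \<in> {?m}"
      using class_eqI[OF f x(1) m(1)] x(2) by simp
  qed
  then have "space \<Lambda> = {?m}"
    using m_tree space by auto
  then show ?thesis
    using null_m by auto
qed

section \<open>Powers of extended nonnegative reals\<close>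

lemma ennpowr_ennreal:
  assumes "0 < x"
  shows "ennpowr (ennreal x) r = ennreal (x powr r)"
  using assms by (auto simp: ennpowr_def ennreal_eq_0_iff)

lemma ennpowr_exponent_0 [simp]: "ennpowr a 0 = 1"
  by (simp add: ennpowr_def)

lemma ennpowr_zero_base: "0 < r \<Longrightarrow> ennpowr 0 r = 0"
  by (simp add: ennpowr_def)

lemma ennpowr_top: "0 < r \<Longrightarrow> ennpowr top r = top"
  by (simp add: ennpowr_def)

lemma ennpowr_exponent_1 [simp]: "ennpowr a 1 = a"
  by (cases a) (auto simp: ennpowr_def ennreal_eq_0_iff)

lemma ennpowr_pos:
  assumes "0 < a" "0 < r"
  shows "0 < ennpowr a r"
  using assms by (cases a) (auto simp: ennpowr_top ennpowr_ennreal ennreal_less_zero_iff)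

text \<open>Serves to normalise the integrands in the Hoelder inequality and to split the factors
  \<open>p\<^sub>0\<close> and \<open>p\<^sub>1\<close> off the persistence powers.\<close>

lemma ennpowr_mult_ennreal:
  assumes "0 < c" "0 < r"
  shows "ennpowr (ennreal c * a) r = ennreal (c powr r) * ennpowr a r"
proof (cases a)
  case (real x)
  show ?thesis
  proof (cases "x = 0")
    case False
    then have "0 < x" using real by simp
    then show ?thesis
      using assms real by (simp add: ennreal_mult[symmetric] ennpowr_ennreal powr_mult)
  qed (use real assms in \<open>simp add: ennpowr_zero_base\<close>)
next
  case top
  then show ?thesis
    using assms ennpowr_top[of r] by (simp add: ennreal_mult_top)
qed

lemma borel_measurable_ennpowr [measurable]: "(\<lambda>a. ennpowr a r) \<in> borel_measurable borel"
  unfolding ennpowr_def by measurable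

section \<open>Young and Hoelder inequalities with extended values\<close>

lemma ennpowr_Young:
  assumes \<theta>: "0 < \<theta>" "\<theta> < 1"
  shows "ennpowr a (1 - \<theta>) * ennpowr b \<theta> \<le> ennreal (1 - \<theta>) * a + ennreal \<theta> * b"
proof (cases "a = 0 \<or> b = 0 \<or> a = \<infinity> \<or> b = \<infinity>")
  \<comment> \<open>If \<open>a\<close> or \<open>b\<close> is 0, so is the left side, even when the
    other is infinite; if one is infinite, so is the right side, because both weights are
    positive.\<close>
  case True
  then show ?thesis
    using \<theta> by (auto simp: ennpowr_zero_base ennreal_mult_top)
next
  case False
  then obtain x y where xy: "a = ennreal x" "b = ennreal y" "0 < x" "0 < y"
    by (cases a; cases b) (auto simp: ennreal_eq_0_iff)
  then show ?thesis
    using Youngs_inequality_0[of "1 - \<theta>" \<theta> x y] \<theta>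
    by (simp add: ennpowr_ennreal ennreal_mult[symmetric] ennreal_plus[symmetric] del: ennreal_plus)
qed

text \<open>Normalise \<open>u\<close> and \<open>v\<close> by their integrals, apply Young's
  inequality pointwise and integrate; the weights sum to 1. The integrands are extended-valued
  because a negative power of the height may be infinite.\<close>

lemma nn_integral_Holder_ennpowr:
  assumes [measurable]: "u \<in> borel_measurable M" "v \<in> borel_measurable M"
    and \<theta>: "0 < \<theta>" "\<theta> < 1"
  shows "(\<integral>\<^sup>+x. ennpowr (u x) (1 - \<theta>) * ennpowr (v x) \<theta> \<partial>M)
    \<le> ennpowr (\<integral>\<^sup>+x. u x \<partial>M) (1 - \<theta>) * ennpowr (\<integral>\<^sup>+x. v x \<partial>M) \<theta>" (is "?I \<le> ennpowr ?A _ * ennpowr ?B _")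
proof -
  consider "?A = 0 \<or> ?B = 0" | "?A \<noteq> 0" "?B \<noteq> 0" "?A = \<infinity> \<or> ?B = \<infinity>"
    | "?A \<noteq> 0" "?B \<noteq> 0" "?A \<noteq> \<infinity>" "?B \<noteq> \<infinity>"
    by blast
  then show ?thesis
  proof cases
    \<comment> \<open>Since 0 times infinity is 0, one vanishing integral makes the right side 0
      whatever the other is; the left integrand then vanishes almost everywhere.\<close>
    case 1
    then have "AE x in M. ennpowr (u x) (1 - \<theta>) * ennpowr (v x) \<theta> = 0"
      using \<theta> by (auto simp: nn_integral_0_iff_AE ennpowr_zero_base elim!: eventually_mono)
    then have "?I = 0"
      by (subst nn_integral_0_iff_AE) auto
    then show ?thesis by simp
  next
    case 2
    have "0 < ?A" "0 < ?B"
      using 2 by (simp_all add: zero_less_iff_neq_zero)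
    then have "0 < ennpowr ?A (1 - \<theta>)" "0 < ennpowr ?B \<theta>"
      using \<theta> by (simp_all add: ennpowr_pos)
    moreover have "ennpowr ?A (1 - \<theta>) = top \<or> ennpowr ?B \<theta> = top"
      using 2(3) \<theta> by (auto simp: ennpowr_top)
    ultimately have "ennpowr ?A (1 - \<theta>) * ennpowr ?B \<theta> = \<infinity>"
      by (auto simp: ennreal_mult_eq_top_iff)
    then show ?thesis by simp
  next
    case 3
    then obtain A B where AB: "?A = ennreal A" "?B = ennreal B" "0 < A" "0 < B"
      by (cases ?A; cases ?B) (auto simp: ennreal_eq_0_iff)
    \<comment> \<open>\<open>?c\<close> is the right side of the claim; it is the factor left over
      when \<open>u\<close> and \<open>v\<close> are rescaled to integral 1.\<close>
    let ?c = "ennreal (A powr (1 - \<theta>) * B powr \<theta>)"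
    have "ennpowr (u x) (1 - \<theta>) * ennpowr (v x) \<theta>
      \<le> ?c * (ennreal (1 - \<theta>) * (ennreal (1 / A) * u x) + ennreal \<theta> * (ennreal (1 / B) * v x))" for x
    proof -
      have scale: "ennreal C * (ennreal (1 / C) * z) = z" if "0 < C" for C z
        using that by (simp add: mult.assoc[symmetric] ennreal_mult[symmetric])
      have "ennpowr (u x) (1 - \<theta>) = ennreal (A powr (1 - \<theta>)) * ennpowr (ennreal (1 / A) * u x) (1 - \<theta>)"
        using ennpowr_mult_ennreal[OF AB(3), of "1 - \<theta>" "ennreal (1 / A) * u x"] \<theta> scale[OF AB(3)] by simp
      moreover have "ennpowr (v x) \<theta> = ennreal (B powr \<theta>) * ennpowr (ennreal (1 / B) * v x) \<theta>"
        using ennpowr_mult_ennreal[OF AB(4), of \<theta> "ennreal (1 / B) * v x"] \<theta> scale[OF AB(4)] by simp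
      ultimately have "ennpowr (u x) (1 - \<theta>) * ennpowr (v x) \<theta>
        = ?c * (ennpowr (ennreal (1 / A) * u x) (1 - \<theta>) * ennpowr (ennreal (1 / B) * v x) \<theta>)"
        by (simp only: ennreal_mult powr_ge_zero ac_simps)
      then show ?thesis
        using mult_left_mono[OF ennpowr_Young[OF \<theta>]] by simp
    qed
    then have "?I \<le> (\<integral>\<^sup>+x. ?c * (ennreal (1 - \<theta>) * (ennreal (1 / A) * u x)
        + ennreal \<theta> * (ennreal (1 / B) * v x)) \<partial>M)"
      by (intro nn_integral_mono)
    also have "\<dots> = ?c * (ennreal (1 - \<theta>) * (ennreal (1 / A) * ?A) + ennreal \<theta> * (ennreal (1 / B) * ?B))"
      by (simp add: nn_integral_cmult nn_integral_add)
    also have "\<dots> = ?c"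
      using AB \<theta> by (simp add: ennreal_mult[symmetric] ennreal_plus[symmetric] del: ennreal_plus)
    also have "\<dots> = ennpowr ?A (1 - \<theta>) * ennpowr ?B \<theta>"
      using AB by (simp add: ennpowr_ennreal ennreal_mult)
    finally show ?thesis .
  qed
qed

section \<open>Interpolation\<close>

lemma nn_integral_height_interpolation:
  assumes f: "continuous_on {0..1} f" and L: "length_measure f \<Lambda>"
    and p: "p\<^sub>0 < p\<^sub>1" "p = (1 - \<theta>) * p\<^sub>0 + \<theta> * p\<^sub>1" and \<theta>: "0 < \<theta>" "\<theta> < 1"
  defines "I \<equiv> \<lambda>q. \<integral>\<^sup>+\<tau>. ennpowr (ennreal (tree_height f \<tau>)) (q - 1) \<partial>\<Lambda>"
  shows "I p \<le> ennpowr (I p\<^sub>0) (1 - \<theta>) * ennpowr (I p\<^sub>1) \<theta>"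
proof -
  note [measurable] = borel_measurable_tree_height[OF f L]
  let ?h = "\<lambda>\<tau>. ennreal (tree_height f \<tau>)"
  define N where "N = {\<tau>\<in>space \<Lambda>. \<not> 0 < tree_height f \<tau>}"
  have N [measurable]: "N \<in> sets \<Lambda>"
    unfolding N_def by measurable
  have pos: "ennpowr (?h \<tau>) (p - 1) = ennpowr (ennpowr (?h \<tau>) (p\<^sub>0 - 1)) (1 - \<theta>) * ennpowr (ennpowr (?h \<tau>) (p\<^sub>1 - 1)) \<theta>"
    if "0 < tree_height f \<tau>" for \<tau>
  proof -
    have "p - 1 = (p\<^sub>0 - 1) * (1 - \<theta>) + (p\<^sub>1 - 1) * \<theta>"
      using p by (simp add: algebra_simps)
    then show ?thesis
      using that by (simp add: ennpowr_ennreal powr_powr powr_add ennreal_mult)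
  qed
  \<comment> \<open>By the Hoelder inequality a bound on the integrands almost everywhere suffices;
    off \<open>N\<close> it is the equality \<open>pos\<close>.\<close>
  have Holder: ?thesis if "AE \<tau> in \<Lambda>. ennpowr (?h \<tau>) (p - 1)
      \<le> ennpowr (ennpowr (?h \<tau>) (p\<^sub>0 - 1)) (1 - \<theta>) * ennpowr (ennpowr (?h \<tau>) (p\<^sub>1 - 1)) \<theta>"
    using nn_integral_mono_AE[OF that] nn_integral_Holder_ennpowr[OF _ _ \<theta>, of "\<lambda>\<tau>. ennpowr (?h \<tau>) (p\<^sub>0 - 1)" \<Lambda>
      "\<lambda>\<tau>. ennpowr (?h \<tau>) (p\<^sub>1 - 1)"]
    unfolding I_def by simp
  consider "emeasure \<Lambda> N = 0" | "1 \<le> p\<^sub>0" | "emeasure \<Lambda> N \<noteq> 0" "p\<^sub>0 < 1"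
    by fastforce
  then show ?thesis
  proof cases
    case 1
    then have "AE \<tau> in \<Lambda>. 0 < tree_height f \<tau>"
      by (intro AE_I[of _ _ N]) (auto simp: N_def)
    then show ?thesis
      by (intro Holder) (auto elim!: eventually_mono simp: pos)
  next
    case 2
    \<comment> \<open>Strictness of \<open>1 < p\<close> matters: where the height is 0, the left
      integrand is 0 for \<open>1 < p\<close>, but it would be 1 for \<open>p = 1\<close>.\<close>
    have "p - p\<^sub>0 = \<theta> * (p\<^sub>1 - p\<^sub>0)"
      using p by (simp add: algebra_simps)
    then have "1 < p"
      using 2 p \<theta> by (smt (verit) mult_pos_pos)
    show ?thesis
    proof (intro Holder AE_I2)
      fix \<tau>
      show "ennpowr (?h \<tau>) (p - 1)
        \<le> ennpowr (ennpowr (?h \<tau>) (p\<^sub>0 - 1)) (1 - \<theta>) * ennpowr (ennpowr (?h \<tau>) (p\<^sub>1 - 1)) \<theta>"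
      proof (cases "0 < tree_height f \<tau>")
        case False
        then show ?thesis
          using \<open>1 < p\<close> by (simp add: ennreal_neg ennpowr_zero_base)
      qed (simp add: pos)
    qed
  next
    case 3
    \<comment> \<open>On \<open>N\<close> the base is 0 and the exponent
      \<open>p\<^sub>0 - 1\<close> is negative, so the integrand is infinite there.\<close>
    have "(\<integral>\<^sup>+\<tau>. \<infinity> * indicator N \<tau> \<partial>\<Lambda>) \<le> I p\<^sub>0"
      unfolding I_def using 3 by (intro nn_integral_mono) (auto simp: indicator_def N_def ennpowr_def ennreal_neg)
    then have "I p\<^sub>0 = \<infinity>"
      using 3(1) nn_integral_cmult_indicator[OF N, of \<infinity>] by (simp only: ennreal_top_mult) (simp add: top_unique)
    have "emeasure \<Lambda> (space \<Lambda>) \<noteq> 0"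
      using 3(1) emeasure_space[of \<Lambda> N] by auto
    then have pos1: "emeasure \<Lambda> {\<tau>\<in>space \<Lambda>. 0 < tree_height f \<tau>} \<noteq> 0"
      using null_tree_if_null_height[OF f L] by blast
    \<comment> \<open>The infinite first factor decides the product only if the second is not 0. A
      positive height has positive powers, so a vanishing integral would contradict
      \<open>pos1\<close>.\<close>
    have "I p\<^sub>1 \<noteq> 0"
    proof
      assume "I p\<^sub>1 = 0"
      then have "AE \<tau> in \<Lambda>. ennpowr (?h \<tau>) (p\<^sub>1 - 1) = 0"
        unfolding I_def by (subst (asm) nn_integral_0_iff_AE) auto
      then have "AE \<tau> in \<Lambda>. \<not> 0 < tree_height f \<tau>"
        by (auto elim!: eventually_mono simp: ennpowr_ennreal ennreal_eq_0_iff)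
      then show False
        using pos1 by (subst (asm) AE_iff_measurable[OF _ refl]) auto
    qed
    then have "ennpowr (I p\<^sub>1) \<theta> \<noteq> 0"
      using ennpowr_pos[of "I p\<^sub>1" \<theta>] \<theta> by (auto simp: zero_less_iff_neq_zero)
    moreover have "ennpowr (I p\<^sub>0) (1 - \<theta>) = \<infinity>"
      using \<open>I p\<^sub>0 = \<infinity>\<close> \<theta> ennpowr_top[of "1 - \<theta>"] by simp
    ultimately have "ennpowr (I p\<^sub>0) (1 - \<theta>) * ennpowr (I p\<^sub>1) \<theta> = \<infinity>"
      by (simp add: ennreal_mult_eq_top_iff)
    then show ?thesis by simp
  qed
qed

theorem proposition2p18:
  fixes f :: "real \<Rightarrow> real" and \<Lambda> :: "real set measure" and p\<^sub>0 p\<^sub>1 \<theta> p :: real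
  assumes "continuous_on {0..1} f"
    and "length_measure f \<Lambda>"
    and "0 < p\<^sub>0" and "p\<^sub>0 < p\<^sub>1" and "\<theta> \<in> {0..1}"
    and "p = (1 - \<theta>) * p\<^sub>0 + \<theta> * p\<^sub>1"
  shows "Pers_pow f \<Lambda> p
    \<le> ennreal (p / (p\<^sub>0 powr (1 - \<theta>) * p\<^sub>1 powr \<theta>))
        * ennpowr (Pers_pow f \<Lambda> p\<^sub>0) (1 - \<theta>) * ennpowr (Pers_pow f \<Lambda> p\<^sub>1) \<theta>"
proof -
  \<comment> \<open>At both endpoints the two sides agree: one power has exponent 0 and is 1, and
    the constant reduces to 1.\<close>
  consider "\<theta> = 0" | "\<theta> = 1" | "0 < \<theta>" "\<theta> < 1"
    using assms(5) by force
  then show ?thesis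
  proof cases
    case 3
    define I where "I q = (\<integral>\<^sup>+\<tau>. ennpowr (ennreal (tree_height f \<tau>)) (q - 1) \<partial>\<Lambda>)" for q
    define c where "c = p\<^sub>0 powr (1 - \<theta>) * p\<^sub>1 powr \<theta>"
    have c: "0 < c"
      using assms(3,4) by (simp add: c_def)
    have p: "0 < p"
      using assms(3-6) 3 by (simp add: add_pos_pos)
    have "Pers_pow f \<Lambda> p = ennreal p * I p"
      by (simp add: Pers_pow_def I_def)
    also have "\<dots> \<le> ennreal p * (ennpowr (I p\<^sub>0) (1 - \<theta>) * ennpowr (I p\<^sub>1) \<theta>)"
      using nn_integral_height_interpolation[OF assms(1,2,4,6) 3] unfolding I_def by (rule mult_left_mono) simp
    \<comment> \<open>The divisor \<open>c\<close> supplies exactly the powers of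
      \<open>p\<^sub>0\<close> and \<open>p\<^sub>1\<close> that turn \<open>I p\<^sub>0\<close> and
      \<open>I p\<^sub>1\<close> into the persistence powers.\<close>
    also have "ennreal p = ennreal (p / c) * (ennreal (p\<^sub>0 powr (1 - \<theta>)) * ennreal (p\<^sub>1 powr \<theta>))"
      using c p by (simp add: ennreal_mult[symmetric] c_def[symmetric])
    also have "\<dots> * (ennpowr (I p\<^sub>0) (1 - \<theta>) * ennpowr (I p\<^sub>1) \<theta>)
      = ennreal (p / c) * (ennreal (p\<^sub>0 powr (1 - \<theta>)) * ennpowr (I p\<^sub>0) (1 - \<theta>))
          * (ennreal (p\<^sub>1 powr \<theta>) * ennpowr (I p\<^sub>1) \<theta>)"
      by (simp only: ac_simps)
    also have "\<dots> = ennreal (p / c) * ennpowr (Pers_pow f \<Lambda> p\<^sub>0) (1 - \<theta>) * ennpowr (Pers_pow f \<Lambda> p\<^sub>1) \<theta>"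
      using assms(3,4) 3 by (simp add: Pers_pow_def I_def ennpowr_mult_ennreal)
    finally show ?thesis
      by (simp add: c_def)
  qed (use assms in auto)
qed

end
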